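(* Let $n\ge3$, $V=[2n]$, and let $h\in\mathcal{F}_n$ take only values in $(-1,0]$. Then the function $h^{\natural}\colon 2^V\to\mathbb{R}$ defined by $h^{\natural}(X)=|X|$ for $|X|\le3$, $h^{\natural}(X)=4+h(X)$ for $|X|=4$, and $h^{\natural}(X)=4$ for $|X|\ge5$, is a valuated generalized matroid.
   Context: The family $\mathcal{F}_n$ ($n\ge3$): let $V=[2n]$, $P_i=\{2i-1,2i\}$ for $i\in[n]$, $\mathcal{H}=\{P_i\cup P_j : i\neq j,\ ij\equiv 0 \bmod 2\}$, and $X^*=P_1\cup P_2$. A function $h\colon\binom{V}{4}\to\mathbb{R}\cup\{-\infty\}$ belongs to $\mathcal{F}_n$ iff $h(X)=0$ for $X\in\binom{V}{4}\setminus\mathcal{H}$, $h(X)<0$ for $X\in\mathcal{H}$, and $h(X^* )$ is the unique largest nonzero value, i.e. $h(X^* )>h(X)$ for all $X\in\mathcal{H}\setminus\{X^*\}$. Valuated generalized matroid: a function $f\colon 2^V\to\mathbb{R}\cup\{-\infty\}$ such that (a) for all $X,Y\subseteq V$ with $|X|<|Y|$: $f(X)+f(Y)\le\max_{j\in Y\setminus X}\{f(X+j)+f(Y-j)\}$; and (b) for all $X,Y\subseteq V$ with $|X|=|Y|$ and all $i\in X\setminus Y$: $f(X)+f(Y)\le\max_{j\in Y\setminus X}\{f(X-i+j)+f(Y+i-j)\}$. *)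

theory Defs
  imports "HOL-Library.Extended_Real" "HOL-Library.FuncSet"
begin

text \<open>
  Functions with values in \<open>\<real> \<union> {-\<infinity>}\<close> are modelled as \<open>ereal\<close>-valued functions that avoid
  \<open>\<infinity>\<close> on the relevant domain; values outside that domain are irrelevant.
\<close>

definition ground :: "nat \<Rightarrow> nat set" where
  "ground n = {1..2 * n}"

definition quads :: "nat \<Rightarrow> nat set set" where
  "quads n = {X. X \<subseteq> ground n \<and> card X = 4}"

definition blk :: "nat \<Rightarrow> nat set" where
  "blk i = {2 * i - 1, 2 * i}"

definition H_sets :: "nat \<Rightarrow> nat set set" where
  "H_sets n = {blk i \<union> blk j | i j. i \<in> {1..n} \<and> j \<in> {1..n} \<and> i \<noteq> j \<and> even (i * j)}"

definition X_star :: "nat set" where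
  "X_star = blk 1 \<union> blk 2"

definition F_family :: "nat \<Rightarrow> (nat set \<Rightarrow> ereal) set" where
  "F_family n = {h \<in> quads n \<rightarrow> - {\<infinity>}.
     (\<forall>X \<in> quads n - H_sets n. h X = 0) \<and>
     (\<forall>X \<in> H_sets n. h X < 0) \<and>
     (\<forall>X \<in> H_sets n - {X_star}. h X < h X_star)}"

text \<open>
  The ground set is finite, and the cardinality hypotheses (in the second condition together with
  \<open>i \<in> X - Y\<close>) force \<open>Y - X\<close> to be nonempty, so every \<open>Max\<close> below is a genuine maximum.
\<close>

definition valuated_gmatroid :: "'a set \<Rightarrow> ('a set \<Rightarrow> ereal) \<Rightarrow> bool" where
  "valuated_gmatroid V f \<longleftrightarrow>
     finite V \<and> f \<in> Pow V \<rightarrow> - {\<infinity>} \<and>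
     (\<forall>X Y. X \<subseteq> V \<longrightarrow> Y \<subseteq> V \<longrightarrow> card X < card Y \<longrightarrow>
        f X + f Y \<le> Max ((\<lambda>j. f (X \<union> {j}) + f (Y - {j})) ` (Y - X))) \<and>
     (\<forall>X Y. X \<subseteq> V \<longrightarrow> Y \<subseteq> V \<longrightarrow> card X = card Y \<longrightarrow> (\<forall>i \<in> X - Y.
        f X + f Y \<le> Max ((\<lambda>j. f ((X - {i}) \<union> {j}) + f ((Y \<union> {i}) - {j})) ` (Y - X))))"

text \<open>
  The extension is real-valued by type.  It is meant for \<open>h\<close> that is finite on 4-element sets
  (in particular with values in \<open>(-1, 0]\<close>), where \<^const>\<open>real_of_ereal\<close> only changes the type.
\<close>

definition h_natural :: "(nat set \<Rightarrow> ereal) \<Rightarrow> nat set \<Rightarrow> real" where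
  "h_natural h X =
     (if card X \<le> 3 then real (card X)
      else if card X = 4 then 4 + real_of_ereal (h X)
      else 4)"

end

theory Submission imports Defs begin

text \<open>
  On a subset \<open>X\<close> of the ground set, \<^term>\<open>h_natural h\<close> takes the value \<open>min |X| 4 - e X\<close>, where the
  penalty \<open>e X\<close> equals \<open>- h X \<in> (0,1)\<close> if \<open>X\<close> belongs to \<open>\<H> =\<close> \<^term>\<open>H_sets n\<close>, and \<open>0\<close> otherwise.
  Without the penalty this is the rank function of a uniform matroid, and every exchange satisfies
  the required inequality because \<open>k \<mapsto> min k 4\<close> is concave.  The penalty is harmless because
  \<open>\<H>\<close> is sparse: each member of \<open>\<H>\<close> is a union of blocks \<open>{2i - 1, 2i}\<close>, so two distinct members
  never differ by the exchange of a single element.  Consequently, among the sets that result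
  from \<open>X\<close> for the various choices of \<open>j\<close> at most one is penalised, and likewise among those that
  result from \<open>Y\<close>.  If there are two choices of \<open>j\<close>, a penalty on a given side can therefore be
  avoided; if there is only one, then \<open>|Y| \<le> |X| + 1\<close>, and the exchange merely swaps \<open>X\<close> and \<open>Y\<close>.
  Controlling one side is enough for \<open>|X| < |Y|\<close>: the other side is either of the wrong size for a penalty, or else \<open>|X| < 4 < |Y|\<close> and
  concavity gains \<open>1\<close>, which pays for it.  For \<open>|X| = |Y|\<close> both sides matter,
  and sparsity is used once more, for the two results of an exchange together.

  This resembles the proof that sparse paving matroids are matroids.  It works for
  arbitrary rank, any sparse family, and any penalties in \<open>[0,1]\<close>, and is carried out in that
  generality in the locale \<open>sparse_penalty\<close>; the two exchange properties are
  \<open>increasing_exchange\<close> and \<open>equicardinal_exchange\<close>.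
\<close>

lemma le_Max_image:
  fixes g :: "'a \<Rightarrow> 'b::linorder"
  assumes "finite S" "j \<in> S" "v \<le> g j"
  shows "v \<le> Max (g ` S)"
  using assms by (meson Max_ge finite_imageI imageI order_trans)

text \<open>
  Two distinct sets of equal size differ by the exchange of one element iff they are \<open>Z + x\<close> and
  \<open>Z + y\<close> for a common \<open>Z\<close>; so \<open>sparse\<close> says that the support of \<open>e\<close> contains no such pair, as for
  the circuit-hyperplanes of a sparse paving matroid.
\<close>

locale sparse_penalty =
  fixes e :: "'a set \<Rightarrow> real" and r :: nat
  assumes nonneg: "0 \<le> e X"
    and le_1: "e X \<le> 1"
    and card_support: "e X \<noteq> 0 \<Longrightarrow> card X = r"
    and sparse: "\<lbrakk>x \<notin> Z; y \<notin> Z; x \<noteq> y\<rbrakk> \<Longrightarrow> e (insert x Z) = 0 \<or> e (insert y Z) = 0"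
begin

lemma sparse_remove:
  assumes "x \<in> Y" "y \<in> Y" "x \<noteq> y"
  shows "e (Y - {x}) = 0 \<or> e (Y - {y}) = 0"
proof -
  have "Y - {x} = insert y (Y - {x, y})" "Y - {y} = insert x (Y - {x, y})"
    using assms by auto
  then show ?thesis
    using sparse[of x "Y - {x, y}" y] assms by auto
qed

lemma sparse_exchange:
  assumes "i \<in> X" "j \<notin> X" "e X \<noteq> 0"
  shows "e (insert j (X - {i})) = 0"
  using sparse[of i "X - {i}" j] assms by (auto simp: insert_absorb)

text \<open>
  If \<open>|Y - X| = 1\<close>, then \<open>Y = X + j\<close> and the exchange swaps \<open>X\<close> and \<open>Y\<close>.  Otherwise some \<open>j = l\<close> leaves
  \<open>X + j\<close> without penalty, and some \<open>j = m\<close> does so for \<open>Y - j\<close>.  For \<open>|X| < r\<close> the former will do: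
  a penalty of \<open>Y - l\<close> requires \<open>|Y| = r + 1\<close>, and then the concave part gains \<open>1\<close>.  For
  \<open>|X| \<ge> r\<close> the set \<open>X + j\<close> is too large to be penalised, so \<open>m\<close> will do.
\<close>

lemma increasing_exchange:
  assumes fin: "finite X" "finite Y" and less: "card X < card Y"
  obtains j where "j \<in> Y - X"
    "real (min (card X) r) - e X + (real (min (card Y) r) - e Y)
     \<le> real (min (card (insert j X)) r) - e (insert j X)
       + (real (min (card (Y - {j})) r) - e (Y - {j}))"
proof -
  note witness = that
  have card_diff: "card Y - card X \<le> card (Y - X)"
    by (simp add: diff_card_le_card_Diff fin)
  have ne: "Y - X \<noteq> {}"
    using card_diff less by force
  have reduce: thesis
    if j: "j \<in> Y - X"
      and gap: "(if card X < r \<and> r < card Y then e (insert j X) + e (Y - {j}) \<le> 1 + e X + e Y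
             else e (insert j X) + e (Y - {j}) \<le> e X + e Y)" for j
  proof (rule witness[OF j])
    have "card (insert j X) = Suc (card X)" "Suc (card (Y - {j})) = card Y"
      using j fin by (simp, intro card_Suc_Diff1) auto
    then show "real (min (card X) r) - e X + (real (min (card Y) r) - e Y)
     \<le> real (min (card (insert j X)) r) - e (insert j X)
       + (real (min (card (Y - {j})) r) - e (Y - {j}))"
      using gap less by (auto split: if_splits simp: min_def not_le)
  qed
  consider (one) j where "Y - X = {j}" | (two) j k where "j \<in> Y - X" "k \<in> Y - X" "j \<noteq> k"
    using ne by blast
  then show thesis
  proof cases
    case (one j)
    have cj: "card Y = Suc (card X)"
      using card_diff one less by simp
    moreover have "card Y = card (X \<inter> Y) + 1"
      using card_Int_Diff[of Y X] one fin by (simp add: Int_commute)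
    ultimately have "X \<inter> Y = X"
      using fin by (intro card_subset_eq) auto
    then have "insert j X = Y" "Y - {j} = X"
      using one by auto
    then show ?thesis
      using one cj by (intro reduce[of j]) auto
  next
    case (two j k)
    obtain l where l: "l \<in> Y - X" "e (insert l X) = 0"
      using sparse[of j X k] two by auto
    obtain m where m: "m \<in> Y - X" "e (Y - {m}) = 0"
      using sparse_remove[of j Y k] two by auto
    have card_remove: "card (Y - {i}) = card Y - 1" if "i \<in> Y - X" for i
      using that fin by simp
    show ?thesis
    proof (cases "card X < r \<and> r < card Y")
      case True
      then show ?thesis
        using l le_1[of "Y - {l}"] nonneg[of X] nonneg[of Y] by (intro reduce[of l]) auto
    next
      case False
      show ?thesis
      proof (cases "card X < r")
        case True
        with False have "e (Y - {l}) = 0"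
          using card_support[of "Y - {l}"] card_remove[of l] l less by fastforce
        then show ?thesis
          using l False nonneg[of X] nonneg[of Y] by (intro reduce[of l]) auto
      next
        case outer: False
        then have "e (insert m X) = 0"
          using card_support[of "insert m X"] m fin by fastforce
        then show ?thesis
          using m False nonneg[of X] nonneg[of Y] by (intro reduce[of m]) auto
      qed
    qed
  qed
qed

text \<open>
  The concave part does not change here, so the total penalty must not increase.  Call two sets
  neighbours if they differ by the exchange of one element.  A penalised \<open>X\<close> or \<open>Y\<close> has no penalised
  neighbour, so only the penalty on the other side has to be avoided.  If neither is penalised, an
  obstruction consists of \<open>Y - X = {a, b}\<close> with \<open>X - i + a\<close> and \<open>Y + i - b\<close> both penalised; but these
  two sets are neighbours.
\<close>

lemma equicardinal_exchange:
  assumes fin: "finite X" "finite Y" and eq: "card X = card Y" and i: "i \<in> X - Y"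
  obtains j where "j \<in> Y - X" "e (insert j (X - {i})) + e (insert i Y - {j}) \<le> e X + e Y"
proof -
  note witness = that
  have card_eq: "card (X - Y) = card (Y - X)"
    using card_Int_Diff[of X Y] card_Int_Diff[of Y X] fin eq by (simp add: Int_commute)
  then have ne: "Y - X \<noteq> {}"
    using i fin by (metis card_eq_0_iff empty_iff finite_Diff)
  consider (one) j where "Y - X = {j}" | (two) j k where "j \<in> Y - X" "k \<in> Y - X" "j \<noteq> k"
    using ne by blast
  then show thesis
  proof cases
    case (one j)
    then have "card (X - Y) = 1"
      using card_eq by simp
    then have "X - Y = {i}"
      using i by (metis card_1_singletonE singletonD)
    then have "insert j (X - {i}) = Y" "insert i Y - {j} = X"
      using one by auto
    then show ?thesis
      using witness[of j] one by auto
  next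
    case (two j k)
    have left: "e (insert a (X - {i})) = 0 \<or> e (insert b (X - {i})) = 0"
      if "a \<in> Y - X" "b \<in> Y - X" "a \<noteq> b" for a b
      using sparse[of a "X - {i}" b] that by auto
    have right: "e (insert i Y - {a}) = 0 \<or> e (insert i Y - {b}) = 0"
      if "a \<in> Y - X" "b \<in> Y - X" "a \<noteq> b" for a b
      using sparse_remove[of a "insert i Y" b] that by auto
    consider "e X \<noteq> 0" | "e Y \<noteq> 0" | "e X = 0" "e Y = 0" by blast
    then show ?thesis
    proof cases
      case 1
      obtain a where "a \<in> Y - X" "e (insert i Y - {a}) = 0"
        using right two by metis
      then show ?thesis
        using witness[of a] sparse_exchange[of i X a] 1 i nonneg[of X] nonneg[of Y] by auto
    next
      case 2
      obtain a where a: "a \<in> Y - X" "e (insert a (X - {i})) = 0"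
        using left two by metis
      moreover have "insert i Y - {a} = insert i (Y - {a})"
        using i a by auto
      ultimately show ?thesis
        using witness[of a] sparse_exchange[of a Y i] 2 i nonneg[of X] nonneg[of Y] by auto
    next
      case 3
      show ?thesis
      proof (rule ccontr)
        assume "\<not> thesis"
        then have bad: "e (insert a (X - {i})) \<noteq> 0 \<or> e (insert i Y - {a}) \<noteq> 0" if "a \<in> Y - X" for a
          using that witness[of a] 3 by force
        obtain a b where ab: "a \<in> Y - X" "b \<in> Y - X" "a \<noteq> b"
          "e (insert a (X - {i})) \<noteq> 0" "e (insert i Y - {b}) \<noteq> 0"
          using bad[of j] bad[of k] left[of j k] right[of j k] two by metis
        \<comment> \<open>A third candidate would incur neither penalty.\<close>
        have YX: "Y - X = {a, b}"
          using bad left[of a] right[of b] ab by blast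
        then have "card (X - Y) = 2"
          using card_eq ab by simp
        then obtain x y where "X - Y = {x, y}" "x \<noteq> y"
          by (auto simp: card_2_iff)
        then obtain i' where i': "X - Y = {i, i'}" "i' \<noteq> i"
          using i by (metis insertE insert_commute singletonD)
        define Z where "Z = insert a (X \<inter> Y)"
        have "insert a (X - {i}) = insert i' Z" "insert i Y - {b} = insert i Z"
          using YX i' ab i unfolding Z_def by blast+
        moreover have "i' \<notin> Z" "i \<notin> Z"
          using i' ab unfolding Z_def by blast+
        ultimately show False
          using sparse[of i' Z i] ab i' by auto
      qed
    qed
  qed
qed

theorem valuated_gmatroid:
  assumes V: "finite V"
    and f: "\<And>X. X \<subseteq> V \<Longrightarrow> f X = real (min (card X) r) - e X"
  shows "valuated_gmatroid V (\<lambda>X. ereal (f X))"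
  unfolding valuated_gmatroid_def
proof (intro conjI allI impI ballI)
  fix X Y
  assume XY: "X \<subseteq> V" "Y \<subseteq> V" and "card X < card Y"
  moreover have fin: "finite X" "finite Y"
    using XY V by (auto intro: finite_subset)
  ultimately obtain j where j: "j \<in> Y - X"
    "real (min (card X) r) - e X + (real (min (card Y) r) - e Y)
     \<le> real (min (card (insert j X)) r) - e (insert j X)
       + (real (min (card (Y - {j})) r) - e (Y - {j}))"
    by (blast intro: increasing_exchange)
  have sub: "insert j X \<subseteq> V" "Y - {j} \<subseteq> V"
    using XY j by auto
  have "f X + f Y \<le> f (insert j X) + f (Y - {j})"
    unfolding f[OF XY(1)] f[OF XY(2)] f[OF sub(1)] f[OF sub(2)] by (fact j(2))
  with j fin show "ereal (f X) + ereal (f Y)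
      \<le> Max ((\<lambda>j. ereal (f (X \<union> {j})) + ereal (f (Y - {j}))) ` (Y - X))"
    by (intro le_Max_image[of _ j]) auto
next
  fix X Y i
  assume XY: "X \<subseteq> V" "Y \<subseteq> V" and eq: "card X = card Y" and i: "i \<in> X - Y"
  have fin: "finite X" "finite Y"
    using XY V by (auto intro: finite_subset)
  obtain j where j: "j \<in> Y - X" "e (insert j (X - {i})) + e (insert i Y - {j}) \<le> e X + e Y"
    using equicardinal_exchange[OF fin eq i] by blast
  have sub: "insert j (X - {i}) \<subseteq> V" "insert i Y - {j} \<subseteq> V"
    using XY j i by auto
  have "Suc (card (X - {i})) = card X"
    using i fin by (intro card_Suc_Diff1) auto
  then have card: "card (insert j (X - {i})) = card X" "card (insert i Y - {j}) = card Y"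
    using i j fin by auto
  have "f X + f Y \<le> f (insert j (X - {i})) + f (insert i Y - {j})"
    unfolding f[OF XY(1)] f[OF XY(2)] f[OF sub(1)] f[OF sub(2)] card using j by simp
  with j fin show "ereal (f X) + ereal (f Y)
      \<le> Max ((\<lambda>j. ereal (f (X - {i} \<union> {j})) + ereal (f (Y \<union> {i} - {j}))) ` (Y - X))"
    by (intro le_Max_image[of _ j]) auto
qed (use V in auto)

end

definition partner :: "nat \<Rightarrow> nat" where
  "partner x = (if even x then x - 1 else x + 1)"

lemma partner_mem_blk:
  assumes "i \<ge> 1" "x \<in> blk i"
  shows "partner x \<in> blk i" "partner x \<noteq> x" "partner (partner x) = x"
proof -
  have "x = 2 * i - 1 \<or> x = 2 * i" "odd (2 * i - 1)"
    using assms by (auto simp: blk_def)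
  then show "partner x \<in> blk i" "partner x \<noteq> x" "partner (partner x) = x"
    using assms(1) by (auto simp: partner_def blk_def)
qed

lemma partner_mem_H_sets:
  assumes "X \<in> H_sets n" "x \<in> X"
  shows "partner x \<in> X" "partner x \<noteq> x" "partner (partner x) = x"
  using assms partner_mem_blk unfolding H_sets_def by (auto; fastforce)+

text \<open>
  The partner of \<open>x\<close> would lie in \<open>Z\<close>, hence in \<open>Z + y\<close>, which forces \<open>x\<close> itself into \<open>Z + y\<close>.
\<close>

lemma H_sets_sparse:
  assumes "x \<notin> Z" "y \<notin> Z" "x \<noteq> y"
  shows "insert x Z \<notin> H_sets n \<or> insert y Z \<notin> H_sets n"
proof (rule ccontr)
  assume "\<not> ?thesis"
  then have H: "insert x Z \<in> H_sets n" "insert y Z \<in> H_sets n"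
    by auto
  have "partner x \<in> Z"
    using partner_mem_H_sets[OF H(1), of x] by auto
  then have "partner (partner x) \<in> insert y Z"
    using partner_mem_H_sets(1)[OF H(2)] by blast
  then show False
    using partner_mem_H_sets(3)[OF H(1), of x] assms by auto
qed

theorem lemma7p12:
  fixes n :: nat and h :: "nat set \<Rightarrow> ereal"
  assumes "n \<ge> 3"
    and "h \<in> F_family n"
    and "\<forall>X \<in> quads n. h X \<in> {-1 <.. 0}"
  shows "valuated_gmatroid (ground n) (\<lambda>X. ereal (h_natural h X))"
proof -
  define e where "e X = (if X \<in> quads n then - real_of_ereal (h X) else 0)" for X
  have bounds: "0 \<le> e X \<and> e X \<le> 1" for X
  proof (cases "X \<in> quads n")
    case True
    then have "-1 < h X" "h X \<le> 0"
      using assms(3) by auto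
    then show ?thesis
      using True by (cases "h X") (auto simp: e_def one_ereal_def)
  qed (simp add: e_def)
  have support: "X \<in> H_sets n" if "e X \<noteq> 0" for X
    using that assms(2) unfolding e_def F_family_def by (auto split: if_splits)
  interpret sparse_penalty e 4
  proof
    show "card X = 4" if "e X \<noteq> 0" for X
      using that unfolding e_def quads_def by (auto split: if_splits)
    show "e (insert x Z) = 0 \<or> e (insert y Z) = 0" if "x \<notin> Z" "y \<notin> Z" "x \<noteq> y" for x y Z
      using H_sets_sparse[OF that] support by blast
  qed (use bounds in auto)
  show ?thesis
  proof (rule valuated_gmatroid)
    show "finite (ground n)"
      by (simp add: ground_def)
    show "h_natural h X = real (min (card X) 4) - e X" if "X \<subseteq> ground n" for X
      using that by (auto simp: h_natural_def e_def quads_def)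
  qed
qed

end
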